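(* Fix an integer $y \ge 1$ and let $$\mathcal{D}_y = \{(x, C) \in \mathbb{N}^2 : x > y \log_2 3,\ C \ge 1,\ (2^x - 3^y) \mid C\}.$$ Then $\mathcal{D}_y$ is not a semilinear subset of $\mathbb{N}^2$ (equivalently, it is not definable in Presburger arithmetic).
   Context: A set $L \subseteq \mathbb{N}^d$ is linear if $L = \{b + \sum_{i=1}^k \lambda_i v_i : \lambda_i \in \mathbb{N}\}$ for some $b \in \mathbb{N}^d$ and finitely many $v_1,\ldots,v_k \in \mathbb{N}^d$; it is semilinear if it is a finite union of linear sets. Presburger arithmetic is the first-order theory of $(\mathbb{N}, +, <, 0, 1)$. *)

theory Defs
  imports "HOL-Analysis.Analysis"
begin

definition linear_set :: "(nat ^ 'd::finite) set \<Rightarrow> bool" where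
  "linear_set L \<longleftrightarrow>
     (\<exists>(b :: nat ^ 'd) (k :: nat) (v :: nat \<Rightarrow> nat ^ 'd).
        L = {b + (\<Sum>i = 1..k. c i *s v i) | c :: nat \<Rightarrow> nat. True})"

definition semilinear_set :: "(nat ^ 'd::finite) set \<Rightarrow> bool" where
  "semilinear_set S \<longleftrightarrow>
     (\<exists>\<L>. finite \<L> \<and> (\<forall>L\<in>\<L>. linear_set L) \<and> S = \<Union>\<L>)"

text \<open>First-order logic with equality over the signature \<open>(+, <, 0, 1)\<close>, with variables
  named by natural numbers, interpreted in the natural numbers.\<close>

datatype pterm = Var nat | Zero | One | Plus pterm pterm

datatype pform =
    Eq pterm pterm
  | Less pterm pterm
  | Neg pform
  | Conj pform pform
  | Disj pform pform
  | Impl pform pform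
  | Exists nat pform
  | Forall nat pform

primrec tvars :: "pterm \<Rightarrow> nat set" where
  "tvars (Var n) = {n}"
| "tvars Zero = {}"
| "tvars One = {}"
| "tvars (Plus s t) = tvars s \<union> tvars t"

primrec free_vars :: "pform \<Rightarrow> nat set" where
  "free_vars (Eq s t) = tvars s \<union> tvars t"
| "free_vars (Less s t) = tvars s \<union> tvars t"
| "free_vars (Neg p) = free_vars p"
| "free_vars (Conj p q) = free_vars p \<union> free_vars q"
| "free_vars (Disj p q) = free_vars p \<union> free_vars q"
| "free_vars (Impl p q) = free_vars p \<union> free_vars q"
| "free_vars (Exists n p) = free_vars p - {n}"
| "free_vars (Forall n p) = free_vars p - {n}"

primrec tval :: "(nat \<Rightarrow> nat) \<Rightarrow> pterm \<Rightarrow> nat" where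
  "tval e (Var n) = e n"
| "tval e Zero = 0"
| "tval e One = 1"
| "tval e (Plus s t) = tval e s + tval e t"

primrec sat :: "(nat \<Rightarrow> nat) \<Rightarrow> pform \<Rightarrow> bool" where
  "sat e (Eq s t) \<longleftrightarrow> tval e s = tval e t"
| "sat e (Less s t) \<longleftrightarrow> tval e s < tval e t"
| "sat e (Neg p) \<longleftrightarrow> \<not> sat e p"
| "sat e (Conj p q) \<longleftrightarrow> sat e p \<and> sat e q"
| "sat e (Disj p q) \<longleftrightarrow> sat e p \<or> sat e q"
| "sat e (Impl p q) \<longleftrightarrow> (sat e p \<longrightarrow> sat e q)"
| "sat e (Exists n p) \<longleftrightarrow> (\<exists>a. sat (e(n := a)) p)"
| "sat e (Forall n p) \<longleftrightarrow> (\<forall>a. sat (e(n := a)) p)"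

text \<open>The injection \<open>x\<close> names the free variable that stands for each coordinate; since all free
  variables of \<open>p\<close> are of this form, the values of \<open>e\<close> elsewhere do not matter.\<close>

definition presburger_definable :: "(nat ^ 'd::finite) set \<Rightarrow> bool" where
  "presburger_definable S \<longleftrightarrow>
     (\<exists>(p :: pform) (x :: 'd \<Rightarrow> nat). inj x \<and> free_vars p \<subseteq> range x \<and>
        (\<forall>(a :: nat ^ 'd) e. (\<forall>i. e (x i) = a $ i) \<longrightarrow> (a \<in> S \<longleftrightarrow> sat e p)))"

definition D :: "nat \<Rightarrow> (nat ^ 2) set" where
  "D y = {vector [x, C] | x C :: nat.
            real x > real y * log 2 3 \<and> C \<ge> 1 \<and> (2 ^ x - 3 ^ y :: int) dvd int C}"

end

theory Submission
  imports
    "HOL-Decision_Procs.Cooper"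
    "HOL-Real_Asymp.Real_Asymp"
    Defs
begin

text \<open>Call \<open>S \<subseteq> \<nat>\<^sup>d\<close> cone shift closed along the \<open>j\<close>-th axis if, inside some cone
  \<open>K (1 + \<Sum>\<^sub>i\<^sub>\<noteq>\<^sub>j a\<^sub>i) < a\<^sub>j\<close> around that axis, it is stable under adding multiples of some
  \<open>M > 0\<close> to the \<open>j\<close>-th coordinate. A point of a linear set inside a narrow enough cone must use a
  generator on the axis, which serves as a period. A Presburger formula is equivalent, by Cooper's
  quantifier elimination, to a Boolean combination of linear inequalities, whose truth value
  inside a narrow cone is invariant along the axis, and of divisibility conditions, which are periodic.
  So semilinear and Presburger definable sets are cone shift closed. But the least element of the fibre
  of \<open>D y\<close> over \<open>x\<close> is \<open>2\<^sup>x - 3\<^sup>y\<close>, which for large \<open>x\<close> lies inside every cone around the second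
  axis, and stability under adding \<open>M\<close> would force \<open>2\<^sup>x - 3\<^sup>y\<close> to divide \<open>M\<close>.\<close>

section \<open>Stability under shifts inside a cone\<close>

definition off_axis_sum :: "'d::finite \<Rightarrow> nat ^ 'd \<Rightarrow> nat" where
  "off_axis_sum j a = (\<Sum>i\<in>UNIV - {j}. a $ i)"

definition cone_shift_closed :: "'d::finite \<Rightarrow> (nat ^ 'd) set \<Rightarrow> bool" where
  "cone_shift_closed j S \<longleftrightarrow> (\<exists>M>0. \<exists>K. \<forall>a\<in>S. \<forall>m. M dvd m \<longrightarrow>
     K * (1 + off_axis_sum j a) < a $ j \<longrightarrow> a + axis j m \<in> S)"

definition cone_periodic :: "'d::finite \<Rightarrow> (nat ^ 'd) set \<Rightarrow> bool" where
  "cone_periodic j S \<longleftrightarrow> cone_shift_closed j S \<and> cone_shift_closed j (- S)"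

lemma off_axis_sum_add: "off_axis_sum j (a + b) = off_axis_sum j a + off_axis_sum j b"
  by (simp add: off_axis_sum_def sum.distrib)

lemma off_axis_sum_scale: "off_axis_sum j (c *s a) = c * off_axis_sum j a"
  by (simp add: off_axis_sum_def sum_distrib_left)

lemma off_axis_sum_axis: "off_axis_sum j (axis j m) = 0"
  by (simp add: off_axis_sum_def axis_def)

lemma off_axis_sum_linear_combination:
  "off_axis_sum j (\<Sum>i\<in>I. c i *s v i) = (\<Sum>i\<in>I. c i * off_axis_sum j (v i))"
proof (induction I rule: infinite_finite_induct)
  case (insert i I)
  then show ?case
    by (simp add: off_axis_sum_add off_axis_sum_scale)
qed (simp_all add: off_axis_sum_def)

lemma off_axis_sum_eq_0_imp_axis: "off_axis_sum j a = 0 \<Longrightarrow> a = axis j (a $ j)"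
  by (auto simp: off_axis_sum_def axis_def vec_eq_iff)

lemma scale_axis: "(c :: 'a :: mult_zero) *s axis j m = axis j (c * m)"
  by (simp add: axis_def vec_eq_iff)

lemma cone_shift_closed_empty: "cone_shift_closed j {}"
  by (auto simp: cone_shift_closed_def)

lemma cone_shift_closed_UNIV: "cone_shift_closed j UNIV"
  by (auto simp: cone_shift_closed_def)

lemma cone_shift_closed_common_bounds:
  assumes "cone_shift_closed j S" "cone_shift_closed j S'"
  obtains M K where "M > 0"
    and "\<And>a m. M dvd m \<Longrightarrow> K * (1 + off_axis_sum j a) < a $ j \<Longrightarrow> a \<in> S \<Longrightarrow> a + axis j m \<in> S"
    and "\<And>a m. M dvd m \<Longrightarrow> K * (1 + off_axis_sum j a) < a $ j \<Longrightarrow> a \<in> S' \<Longrightarrow> a + axis j m \<in> S'"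
proof -
  obtain M K where "M > 0" and S: "\<And>a m. M dvd m \<Longrightarrow> K * (1 + off_axis_sum j a) < a $ j \<Longrightarrow>
      a \<in> S \<Longrightarrow> a + axis j m \<in> S"
    using assms(1) unfolding cone_shift_closed_def by blast
  obtain M' K' where "M' > 0" and S': "\<And>a m. M' dvd m \<Longrightarrow> K' * (1 + off_axis_sum j a) < a $ j \<Longrightarrow>
      a \<in> S' \<Longrightarrow> a + axis j m \<in> S'"
    using assms(2) unfolding cone_shift_closed_def by blast
  have cones: "K * n < c" "K' * n < c" if "(K + K') * n < c" for n c
    using that by (simp_all add: distrib_right)
  show thesis
  proof (rule that[of _ "K + K'"])
    show "M * M' > 0"
      using \<open>M > 0\<close> \<open>M' > 0\<close> by simp
  qed (blast intro: S S' cones dvd_mult_left dvd_mult_right)+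
qed

lemma cone_shift_closed_Un:
  assumes "cone_shift_closed j S" "cone_shift_closed j S'"
  shows "cone_shift_closed j (S \<union> S')"
  by (rule cone_shift_closed_common_bounds[OF assms]) (unfold cone_shift_closed_def, blast)

lemma cone_shift_closed_Int:
  assumes "cone_shift_closed j S" "cone_shift_closed j S'"
  shows "cone_shift_closed j (S \<inter> S')"
  by (rule cone_shift_closed_common_bounds[OF assms]) (unfold cone_shift_closed_def, blast)

lemma cone_periodic_empty: "cone_periodic j {}"
  by (simp add: cone_periodic_def cone_shift_closed_empty cone_shift_closed_UNIV)

lemma cone_periodic_UNIV: "cone_periodic j UNIV"
  by (simp add: cone_periodic_def cone_shift_closed_empty cone_shift_closed_UNIV)

lemma cone_periodic_Compl: "cone_periodic j S \<Longrightarrow> cone_periodic j (- S)"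
  by (simp add: cone_periodic_def)

lemma cone_periodic_Un: "cone_periodic j S \<Longrightarrow> cone_periodic j S' \<Longrightarrow> cone_periodic j (S \<union> S')"
  by (simp add: cone_periodic_def cone_shift_closed_Un cone_shift_closed_Int)

lemma cone_periodic_Int: "cone_periodic j S \<Longrightarrow> cone_periodic j S' \<Longrightarrow> cone_periodic j (S \<inter> S')"
  by (simp add: cone_periodic_def cone_shift_closed_Un cone_shift_closed_Int)

section \<open>Semilinear sets\<close>

lemma linear_combination_add_generator:
  fixes v :: "'i \<Rightarrow> 'a::semiring_1 ^ 'd"
  assumes "finite I" "i \<in> I"
  shows "(\<Sum>j\<in>I. c j *s v j) + q *s v i = (\<Sum>j\<in>I. (c(i := c i + q)) j *s v j)"
  using assms by (simp add: sum.remove[of I i] vector_sadd_rdistrib ac_simps)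

lemma cone_shift_closed_axis_generator:
  assumes "finite I" "i \<in> I" "off_axis_sum j (v i) = 0" "v i $ j > 0"
  shows "cone_shift_closed j {b + (\<Sum>i\<in>I. c i *s v i) | c. True}" (is "cone_shift_closed j ?L")
proof -
  have "a + axis j m \<in> ?L" if "a \<in> ?L" and dvd: "v i $ j dvd m" for a m
  proof -
    obtain c where a: "a = b + (\<Sum>i\<in>I. c i *s v i)"
      using \<open>a \<in> ?L\<close> by blast
    obtain q where "m = q * (v i $ j)"
      using dvd by (metis dvdE mult.commute)
    then have "axis j m = q *s v i"
      using off_axis_sum_eq_0_imp_axis[OF assms(3)] by (metis scale_axis)
    then have "a + axis j m = b + (\<Sum>l\<in>I. (c(i := c i + q)) l *s v l)"
      by (simp only: a add.assoc linear_combination_add_generator[OF assms(1,2)])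
    then show ?thesis
      by blast
  qed
  then show ?thesis
    unfolding cone_shift_closed_def using \<open>v i $ j > 0\<close> by blast
qed

lemma linear_combination_outside_cone:
  fixes v :: "'i \<Rightarrow> nat ^ 'd::finite"
  assumes "\<And>i. i \<in> I \<Longrightarrow> off_axis_sum j (v i) > 0 \<or> v i $ j = 0" and "finite I"
    and a_eq: "a = b + (\<Sum>i\<in>I. c i *s v i)"
  shows "a $ j \<le> (b $ j + (\<Sum>i\<in>I. v i $ j)) * (1 + off_axis_sum j a)"
proof -
  let ?r = "off_axis_sum j a"
  have "c i * v i $ j \<le> v i $ j * ?r" if i: "i \<in> I" for i
  proof (cases "v i $ j = 0")
    case False
    then have "c i \<le> c i * off_axis_sum j (v i)"
      using assms(1)[OF i] by simp
    also have "\<dots> \<le> (\<Sum>i\<in>I. c i * off_axis_sum j (v i))"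
      using i \<open>finite I\<close> by (intro member_le_sum) auto
    also have "\<dots> \<le> ?r"
      by (simp add: a_eq off_axis_sum_add off_axis_sum_linear_combination)
    finally show ?thesis
      by simp
  qed simp
  then have "a $ j \<le> b $ j + (\<Sum>i\<in>I. v i $ j * ?r)"
    by (simp add: a_eq sum_mono)
  also have "\<dots> = b $ j + (\<Sum>i\<in>I. v i $ j) * ?r"
    by (simp add: sum_distrib_right)
  also have "\<dots> \<le> (b $ j + (\<Sum>i\<in>I. v i $ j)) * (1 + ?r)"
    by (simp add: algebra_simps)
  finally show ?thesis .
qed

lemma linear_set_imp_cone_shift_closed:
  assumes "linear_set L"
  shows "cone_shift_closed j L"
proof -
  obtain b k v where L: "L = {b + (\<Sum>i = 1..k. c i *s v i) | c :: nat \<Rightarrow> nat. True}"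
    using assms unfolding linear_set_def by blast
  show ?thesis
  proof (cases "\<exists>i\<in>{1..k}. off_axis_sum j (v i) = 0 \<and> v i $ j > 0")
    case True
    then show ?thesis
      unfolding L using cone_shift_closed_axis_generator[OF finite_atLeastAtMost] by blast
  next
    case False
    then have "a $ j \<le> (b $ j + (\<Sum>i = 1..k. v i $ j)) * (1 + off_axis_sum j a)" if "a \<in> L" for a
      using that linear_combination_outside_cone[of "{1..k}" j v] unfolding L by force
    then show ?thesis
      unfolding cone_shift_closed_def by (meson not_le zero_less_one)
  qed
qed

lemma semilinear_set_imp_cone_shift_closed:
  assumes "semilinear_set S"
  shows "cone_shift_closed j S"
proof -
  obtain \<L> where \<L>: "finite \<L>" "\<forall>L\<in>\<L>. linear_set L" and S: "S = \<Union>\<L>"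
    using assms unfolding semilinear_set_def by blast
  from \<L> have "cone_shift_closed j (\<Union>\<L>)"
    by (induction \<L>)
      (simp_all add: cone_shift_closed_empty cone_shift_closed_Un linear_set_imp_cone_shift_closed)
  then show ?thesis
    by (simp add: S)
qed

section \<open>Quantifier-free formulas\<close>

definition integer_affine :: "(nat ^ 'd::finite \<Rightarrow> int) \<Rightarrow> bool" where
  "integer_affine f \<longleftrightarrow> (\<exists>u d. \<forall>a. f a = (\<Sum>i\<in>UNIV. u i * int (a $ i)) + d)"

lemma integer_affine_const: "integer_affine (\<lambda>a. d)"
  unfolding integer_affine_def by (intro exI[of _ "\<lambda>_. 0"] exI[of _ d]) simp

lemma integer_affine_component: "integer_affine (\<lambda>a. int (a $ i))"
  unfolding integer_affine_def by (intro exI[of _ "\<lambda>l. of_bool (l = i)"] exI[of _ 0]) simp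

lemma integer_affine_add:
  assumes "integer_affine f" "integer_affine g"
  shows "integer_affine (\<lambda>a. f a + g a)"
proof -
  obtain u d where "\<And>a. f a = (\<Sum>i\<in>UNIV. u i * int (a $ i)) + d"
    using assms(1) unfolding integer_affine_def by blast
  moreover obtain w e where "\<And>a. g a = (\<Sum>i\<in>UNIV. w i * int (a $ i)) + e"
    using assms(2) unfolding integer_affine_def by blast
  ultimately show ?thesis
    unfolding integer_affine_def
    by (intro exI[of _ "\<lambda>i. u i + w i"] exI[of _ "d + e"]) (simp add: distrib_right sum.distrib)
qed

lemma integer_affine_cmult:
  assumes "integer_affine f"
  shows "integer_affine (\<lambda>a. z * f a)"
proof -
  obtain u d where "\<And>a. f a = (\<Sum>i\<in>UNIV. u i * int (a $ i)) + d"
    using assms unfolding integer_affine_def by blast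
  then show ?thesis
    unfolding integer_affine_def
    by (intro exI[of _ "\<lambda>i. z * u i"] exI[of _ "z * d"])
      (simp add: distrib_left sum_distrib_left mult.assoc)
qed

lemma integer_affine_uminus: "integer_affine f \<Longrightarrow> integer_affine (\<lambda>a. - f a)"
  using integer_affine_cmult[of f "- 1"] by simp

lemma integer_affine_diff:
  "integer_affine f \<Longrightarrow> integer_affine g \<Longrightarrow> integer_affine (\<lambda>a. f a - g a)"
  using integer_affine_add[of f "\<lambda>a. - g a"] integer_affine_uminus[of g] by simp

lemma integer_affine_slope_along_axis:
  assumes "integer_affine f"
  obtains s K where "\<And>a m. f (a + axis j m) = f a + s * int m"
    and "\<And>a. \<bar>f a - s * int (a $ j)\<bar> \<le> int (K * (1 + off_axis_sum j a))"
proof -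
  obtain u d where "\<And>a. f a = (\<Sum>i\<in>UNIV. u i * int (a $ i)) + d"
    using assms unfolding integer_affine_def by blast
  then have f: "f a = u j * int (a $ j) + (\<Sum>i\<in>UNIV - {j}. u i * int (a $ i)) + d" for a
    by (simp add: sum.remove[of UNIV j])
  define K where "K = nat ((\<Sum>i\<in>UNIV - {j}. \<bar>u i\<bar>) + \<bar>d\<bar>)"
  have int_K: "int K = (\<Sum>i\<in>UNIV - {j}. \<bar>u i\<bar>) + \<bar>d\<bar>"
    by (simp add: K_def sum_nonneg)
  have u_le: "\<bar>u i\<bar> \<le> int K" if "i \<noteq> j" for i
    unfolding int_K using that member_le_sum[of i "UNIV - {j}" "\<lambda>i. \<bar>u i\<bar>"] by simp
  have d_le: "\<bar>d\<bar> \<le> int K"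
    by (simp add: int_K sum_nonneg)
  show thesis
  proof (rule that)
    show "f (a + axis j m) = f a + u j * int m" for a m
      by (simp add: f axis_def algebra_simps)
    have "\<bar>f a - u j * int (a $ j)\<bar> \<le> (\<Sum>i\<in>UNIV - {j}. \<bar>u i * int (a $ i)\<bar>) + \<bar>d\<bar>" for a
      using sum_abs[of "\<lambda>i. u i * int (a $ i)" "UNIV - {j}"] unfolding f by linarith
    also have "\<dots> a \<le> (\<Sum>i\<in>UNIV - {j}. int K * int (a $ i)) + int K" for a
      using u_le d_le by (intro add_mono sum_mono) (auto simp: abs_mult intro: mult_right_mono)
    also have "\<dots> a = int (K * (1 + off_axis_sum j a))" for a
      by (simp add: off_axis_sum_def sum_distrib_left algebra_simps)
    finally show "\<bar>f a - u j * int (a $ j)\<bar> \<le> int (K * (1 + off_axis_sum j a))" for a .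
  qed
qed

lemma sgn_near_multiple:
  fixes s t c :: int
  assumes "\<bar>t - s * c\<bar> < c" "s \<noteq> 0"
  shows "sgn t = sgn s"
proof (cases "s > 0")
  case True
  then have "1 * c \<le> s * c"
    using assms(1) by (intro mult_right_mono) auto
  then show ?thesis
    using assms(1) True by simp
next
  case False
  then have "s * c \<le> - 1 * c"
    using assms by (intro mult_right_mono) auto
  then show ?thesis
    using assms False by simp
qed

lemma cone_shift_closed_sgn_affine:
  assumes "integer_affine f"
  shows "cone_shift_closed j {a. P (sgn (f a))}"
proof -
  obtain s K where shift: "\<And>a m. f (a + axis j m) = f a + s * int m"
    and slope: "\<And>a. \<bar>f a - s * int (a $ j)\<bar> \<le> int (K * (1 + off_axis_sum j a))"
    using integer_affine_slope_along_axis[OF assms] by blast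
  have sgn_cone: "sgn (f a) = sgn s" if "K * (1 + off_axis_sum j a) < a $ j" "s \<noteq> 0" for a
    using slope[of a] that by (intro sgn_near_multiple[of _ _ "int (a $ j)"]) linarith+
  have "sgn (f (a + axis j m)) = sgn (f a)" if cone: "K * (1 + off_axis_sum j a) < a $ j" for a m
  proof (cases "s = 0")
    case False
    have "K * (1 + off_axis_sum j (a + axis j m)) < (a + axis j m) $ j"
      using cone by (simp add: off_axis_sum_add off_axis_sum_axis)
    then show ?thesis
      using sgn_cone cone False by simp
  qed (simp add: shift)
  then show ?thesis
    unfolding cone_shift_closed_def by (intro exI[of _ 1] exI[of _ K] conjI) auto
qed

lemma cone_periodic_sgn_affine:
  "integer_affine f \<Longrightarrow> cone_periodic j {a. P (sgn (f a))}"
  using cone_shift_closed_sgn_affine[of f j P] cone_shift_closed_sgn_affine[of f j "\<lambda>s. \<not> P s"]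
  by (simp add: cone_periodic_def Collect_neg_eq)

lemma cone_periodic_dvd_affine:
  assumes "integer_affine f"
  shows "cone_periodic j {a. k dvd f a}"
proof (cases "k = 0")
  case True
  then show ?thesis
    using cone_periodic_sgn_affine[OF assms, of j "\<lambda>s. s = 0"] by (simp add: sgn_0_0)
next
  case False
  obtain s where shift: "\<And>a m. f (a + axis j m) = f a + s * int m"
    using integer_affine_slope_along_axis[OF assms, of j] by metis
  have "k dvd f (a + axis j m) \<longleftrightarrow> k dvd f a" if "nat \<bar>k\<bar> dvd m" for a m
  proof -
    have "k dvd s * int m"
      using that by (simp add: nat_abs_dvd_iff)
    then show ?thesis
      unfolding shift by (rule dvd_add_left_iff)
  qed
  then show ?thesis
    unfolding cone_periodic_def cone_shift_closed_def using False
    by (intro conjI exI[of _ "nat \<bar>k\<bar>"] exI[of _ 0]) auto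
qed

lemma integer_affine_Inum:
  assumes "\<And>n. integer_affine (\<lambda>a. bs a ! n)"
  shows "integer_affine (\<lambda>a. Inum (bs a) t)"
  by (induction t)
    (simp_all add: assms integer_affine_const integer_affine_add integer_affine_cmult
      integer_affine_uminus integer_affine_diff)

lemma cone_periodic_qfree:
  assumes "\<And>n. integer_affine (\<lambda>a. bs a ! n)" "qfree p"
  shows "cone_periodic j {a. Ifm bbs (bs a) p}"
proof -
  note sgn_Inum = cone_periodic_sgn_affine[OF integer_affine_Inum[OF assms(1)]]
  note dvd_Inum = cone_periodic_dvd_affine[OF integer_affine_Inum[OF assms(1)]]
  note boolean = cone_periodic_empty cone_periodic_UNIV cone_periodic_Compl cone_periodic_Un
    cone_periodic_Int Collect_neg_eq Collect_disj_eq Collect_conj_eq Collect_imp_eq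
  show ?thesis
    using assms(2)
  proof (induction p)
    case (Lt t)
    show ?case
      using sgn_Inum[of j "\<lambda>s. s < 0" t] by simp
  next
    case (Le t)
    show ?case
      using sgn_Inum[of j "\<lambda>s. \<not> s > 0" t] by (simp add: not_less)
  next
    case (Gt t)
    show ?case
      using sgn_Inum[of j "\<lambda>s. s > 0" t] by simp
  next
    case (Ge t)
    show ?case
      using sgn_Inum[of j "\<lambda>s. \<not> s < 0" t] by (simp add: not_less)
  next
    case (Eq t)
    show ?case
      using sgn_Inum[of j "\<lambda>s. s = 0" t] by (simp add: sgn_0_0)
  next
    case (NEq t)
    show ?case
      using sgn_Inum[of j "\<lambda>s. s \<noteq> 0" t] by (simp add: sgn_0_0)
  next
    case (Iff p q)
    then show ?case
      by (simp add: boolean iff_conv_conj_imp)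
  qed (simp_all add: boolean dvd_Inum)
qed

section \<open>Presburger definable sets\<close>

primrec num_of_pterm :: "(nat \<Rightarrow> nat) \<Rightarrow> pterm \<Rightarrow> num" where
  "num_of_pterm f (Var n) = Bound (f n)"
| "num_of_pterm f Zero = C 0"
| "num_of_pterm f One = C 1"
| "num_of_pterm f (Plus s t) = Add (num_of_pterm f s) (num_of_pterm f t)"

text \<open>The map \<open>f\<close> sends each variable name to its de Bruijn index; quantifiers, which range over
  the integers in Cooper's formulas, are relativised to the nonnegative ones.\<close>

primrec fm_of_pform :: "(nat \<Rightarrow> nat) \<Rightarrow> pform \<Rightarrow> fm" where
  "fm_of_pform f (Defs.Eq s t) = fm.Eq (Sub (num_of_pterm f s) (num_of_pterm f t))"
| "fm_of_pform f (Less s t) = Lt (Sub (num_of_pterm f s) (num_of_pterm f t))"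
| "fm_of_pform f (Defs.Neg p) = Not (fm_of_pform f p)"
| "fm_of_pform f (Conj p q) = And (fm_of_pform f p) (fm_of_pform f q)"
| "fm_of_pform f (Disj p q) = Or (fm_of_pform f p) (fm_of_pform f q)"
| "fm_of_pform f (Impl p q) = Imp (fm_of_pform f p) (fm_of_pform f q)"
| "fm_of_pform f (Exists n p) =
     E (And (Ge (Bound 0)) (fm_of_pform ((\<lambda>m. Suc (f m))(n := 0)) p))"
| "fm_of_pform f (Forall n p) =
     A (Imp (Ge (Bound 0)) (fm_of_pform ((\<lambda>m. Suc (f m))(n := 0)) p))"

lemma Inum_num_of_pterm:
  "(\<And>n. n \<in> tvars t \<Longrightarrow> bs ! f n = int (e n)) \<Longrightarrow> Inum bs (num_of_pterm f t) = int (tval e t)"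
  by (induction t) auto

lemma Ifm_fm_of_pform:
  "(\<And>n. n \<in> free_vars p \<Longrightarrow> bs ! f n = int (e n)) \<Longrightarrow> Ifm bbs bs (fm_of_pform f p) = sat e p"
proof (induction p arbitrary: f bs e)
  case (Exists n p)
  have "Ifm bbs (int a # bs) (fm_of_pform ((\<lambda>m. Suc (f m))(n := 0)) p) = sat (e(n := a)) p" for a
    using Exists.prems by (intro Exists.IH) auto
  then show ?case
    by simp (metis nat_0_le of_nat_0_le_iff)
next
  case (Forall n p)
  have "Ifm bbs (int a # bs) (fm_of_pform ((\<lambda>m. Suc (f m))(n := 0)) p) = sat (e(n := a)) p" for a
    using Forall.prems by (intro Forall.IH) auto
  then show ?case
    by simp (metis nat_0_le of_nat_0_le_iff)
next
  case (Conj p q)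
  with Conj.IH[of bs f e] show ?case
    by simp
next
  case (Disj p q)
  with Disj.IH[of bs f e] show ?case
    by simp
next
  case (Impl p q)
  with Impl.IH[of bs f e] show ?case
    by simp
next
  case (Eq s t)
  then show ?case
    by (simp add: Inum_num_of_pterm[of _ bs f e])
next
  case (Less s t)
  then show ?case
    by (simp add: Inum_num_of_pterm[of _ bs f e])
qed simp

text \<open>Beyond its length, \<open>nth\<close> returns a junk value that depends only on the index and the length;
  hence no bound on the variables of the quantifier-free formula is needed.\<close>

lemma integer_affine_nth_map_components:
  fixes xs :: "'d::finite list"
  shows "integer_affine (\<lambda>a. map (\<lambda>i. int (a $ i)) xs ! n)"
proof (cases "n < length xs")
  case True
  then show ?thesis
    by (simp add: integer_affine_component)
next
  case False
  then have "map (\<lambda>i. int (a $ i)) xs ! n = [] ! (n - length xs)" for a :: "nat ^ 'd"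
    using nth_append[of "map (\<lambda>i. int (a $ i)) xs" "[]" n] by simp
  then show ?thesis
    by (simp add: integer_affine_const)
qed

lemma presburger_definable_imp_qfree:
  fixes S :: "(nat ^ 'd::finite) set"
  assumes "presburger_definable S"
  obtains p xs where "qfree p" "\<And>a. a \<in> S \<longleftrightarrow> Ifm [] (map (\<lambda>i. int (a $ i)) xs) p"
proof -
  obtain p and v :: "'d \<Rightarrow> nat" where v: "inj v" "free_vars p \<subseteq> range v"
    and S: "\<And>a e. (\<And>i. e (v i) = a $ i) \<Longrightarrow> a \<in> S \<longleftrightarrow> sat e p"
    using assms unfolding presburger_definable_def by auto
  have "finite (range v)"
    by simp
  then obtain N where N: "range v \<subseteq> {..<N}"
    unfolding finite_nat_iff_bounded by blast
  have less_N: "n < N" if "n \<in> free_vars p" for n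
    using v(2) N that by blast
  \<comment> \<open>Indices outside \<open>range v\<close> get an arbitrary component, which \<open>p\<close> does not see.\<close>
  define vs where "vs = map (inv v) [0..<N]"
  have "a \<in> S \<longleftrightarrow> Ifm [] (map (\<lambda>i. int (a $ i)) vs) (fm_of_pform id p)" for a
  proof -
    have "a \<in> S \<longleftrightarrow> sat (\<lambda>n. a $ inv v n) p"
      using v(1) by (intro S) simp
    also have "\<dots> \<longleftrightarrow> Ifm [] (map (\<lambda>i. int (a $ i)) vs) (fm_of_pform id p)"
      by (intro Ifm_fm_of_pform[symmetric]) (simp add: vs_def less_N)
    finally show ?thesis .
  qed
  then show thesis
    using mirqe that[of "pa (fm_of_pform id p)" vs] by blast
qed

lemma presburger_definable_imp_cone_shift_closed:
  assumes "presburger_definable S"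
  shows "cone_shift_closed j S"
proof -
  obtain p xs where "qfree p" and S: "\<And>a. a \<in> S \<longleftrightarrow> Ifm [] (map (\<lambda>i. int (a $ i)) xs) p"
    using presburger_definable_imp_qfree[OF assms] by blast
  then have "cone_periodic j {a. Ifm [] (map (\<lambda>i. int (a $ i)) xs) p}"
    by (intro cone_periodic_qfree integer_affine_nth_map_components)
  then show ?thesis
    by (simp add: S[symmetric] cone_periodic_def)
qed

section \<open>The divisibility set\<close>

lemma vector_in_D_iff:
  "vector [x, c] \<in> D y \<longleftrightarrow> (3::nat) ^ y < 2 ^ x \<and> c \<ge> 1 \<and> 2 ^ x - 3 ^ y dvd c"
proof -
  have "real y * log 2 3 < real x \<longleftrightarrow> log 2 (3 ^ y) < real x"
    by (simp add: log_nat_power)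
  also have "\<dots> \<longleftrightarrow> (3 ^ y :: real) < 2 ^ x"
    by (simp add: log_less_iff powr_realpow)
  also have "\<dots> \<longleftrightarrow> (3::nat) ^ y < 2 ^ x"
    unfolding of_nat_less_iff[where 'a = real, symmetric] by simp
  finally have log_iff: "real y * log 2 3 < real x \<longleftrightarrow> (3::nat) ^ y < 2 ^ x" .
  have "(2 ^ x - 3 ^ y :: int) dvd int c \<longleftrightarrow> 2 ^ x - 3 ^ y dvd c" if "(3::nat) ^ y < 2 ^ x"
  proof -
    have "(2 ^ x - 3 ^ y :: int) = int (2 ^ x - 3 ^ y)"
      using that by (simp add: of_nat_diff)
    then show ?thesis
      by (simp only: int_dvd_int_iff)
  qed
  then show ?thesis
    unfolding D_def by (auto simp: vec_eq_iff forall_2 log_iff)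
qed

lemma eventually_linear_less_exp2: "\<forall>\<^sub>F x in sequentially. k * x + d < (2::nat) ^ x"
proof -
  have "\<forall>\<^sub>F x in sequentially. real (k * x + d) < real (2 ^ x)"
    by (simp, real_asymp)
  then show ?thesis
    by (simp only: of_nat_less_iff)
qed

lemma not_cone_shift_closed_D: "\<not> cone_shift_closed 2 (D y)"
proof
  assume "cone_shift_closed 2 (D y)"
  then obtain M K where "M > 0" and shift: "\<And>a. K * (1 + off_axis_sum 2 a) < a $ 2 \<Longrightarrow> a \<in> D y \<Longrightarrow>
      a + axis 2 M \<in> D y"
    unfolding cone_shift_closed_def by (metis dvd_refl)
  obtain x where x: "K * x + (K + M + 3 ^ y) < 2 ^ x"
    using eventually_happens'[OF sequentially_bot eventually_linear_less_exp2] by blast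
  define c :: nat where "c = 2 ^ x - 3 ^ y"
  define a :: "nat ^ 2" where "a = vector [x, c]"
  have "UNIV - {2 :: 2} = {1}"
    using exhaust_2 by auto
  then have "off_axis_sum 2 a = x"
    by (simp add: off_axis_sum_def a_def)
  then have "K * (1 + off_axis_sum 2 a) < a $ 2"
    using x by (simp add: a_def c_def)
  moreover have "a \<in> D y"
    using x by (simp add: a_def vector_in_D_iff c_def)
  ultimately have "a + axis 2 M \<in> D y"
    by (rule shift)
  also have "a + axis 2 M = vector [x, c + M]"
    by (simp add: a_def vec_eq_iff forall_2 axis_def)
  finally have "c dvd M"
    by (simp add: vector_in_D_iff c_def[symmetric])
  moreover have "M < c"
    using x by (simp add: c_def)
  ultimately show False
    using \<open>M > 0\<close> by (auto dest: dvd_imp_le)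
qed

theorem theorem7p1:
  fixes y :: nat
  assumes "y \<ge> 1"
  shows "\<not> semilinear_set (D y) \<and> \<not> presburger_definable (D y)"
  using not_cone_shift_closed_D semilinear_set_imp_cone_shift_closed
    presburger_definable_imp_cone_shift_closed by blast

end
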